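(* Let $\mathbf{k}$ be an algebraically closed field, $V=\mathbf{k}^n$, $G=\mathrm{GL}(V)$, $\underline{G}=G\ltimes V$. Let $(X,w)\in\mathcal{O}_{\lambda[q]}$ with $\lambda=(a_1\ge\dots\ge a_t>0)$. For $k\in\{0,1,\dots,t\}$, the enhanced number $\wp_k^{\lambda[q]}$ equals the maximum of $\dim\big(\mathbf{k}[X]\tilde w+\mathbf{k}[X]\nu_1+\dots+\mathbf{k}[X]\nu_k\big)$ as $\tilde w$ ranges over $w+\mathrm{im}\,X$ and $(\nu_1,\dots,\nu_k)$ ranges over $V^k$.
   Context: $\underline{G}$ is $G\times V$ with product $(g_1,v_1)(g_2,v_2)=(g_1g_2,g_1v_2+v_1)$ and adjoint action $\mathrm{Ad}(g,v)(X,w)=(gXg^{-1},-(gXg^{-1})v+gw)$. Write $\lambda=(b_1^{d_1}\cdots b_r^{d_r})$ with $b_1>\dots>b_r$ (each $b_i$ occurring $d_i>0$ times), $d_0=0$; an enhanced partition $\lambda[q]$ has $q\in\{d_0+\dots+d_{j-1}:1\le j\le r+1\}$. For a nilpotent of type $\lambda$ with Jordan basis $\{X^kv_i:1\le i\le t, 0\le k\le a_i-1\}$, $X^{a_i}v_i=0$, put $u_j=v_{d_1+\dots+d_j}$ ($1\le j\le r$), $u_{r+1}=0$; $\mathcal{O}_{\lambda[q]}$ is the $\underline{G}$-orbit of $(X,u_j)$ with $q=d_0+\dots+d_{j-1}$. With the convention $a_i=0$ for $i>t$, the enhanced number is $\wp_k^{\lambda[q]}=\sum_{i=1}^k a_i+\delta_{k+1,q}$,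 where $\delta_{k+1,q}=a_{k+1}$ if $k+1>q$ and $\delta_{k+1,q}=a_{k+1}-1$ otherwise. $\mathbf{k}[X]u$ denotes the span of $u,Xu,X^2u,\dots$. *)

theory Defs
  imports "HOL-Analysis.Analysis" "HOL-Computational_Algebra.Polynomial"
begin

text \<open>Vectors: V = k^n is the type ('k, 'n) vec = 'k ^ 'n, with 'n a finite index type,
  n = CARD('n). Endomorphisms of V are k-linear functions V \<Rightarrow> V; G = GL(V) consists of the
  bijective linear ones. A partition lambda = (a_1 \<ge> ... \<ge> a_t > 0) is a list; a_i is 1-indexed
  and a_i = 0 for i > t.\<close>

definition is_partition_of :: "nat list \<Rightarrow> nat \<Rightarrow> bool" where
  "is_partition_of lam n \<longleftrightarrow> sorted_wrt (\<ge>) lam \<and> (\<forall>x\<in>set lam. 0 < x) \<and> sum_list lam = n"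

definition part_a :: "nat list \<Rightarrow> nat \<Rightarrow> nat" where
  "part_a lam i = (if 1 \<le> i \<and> i \<le> length lam then lam ! (i - 1) else 0)"

text \<open>lambda = (b_1^{d_1} ... b_r^{d_r}), b_1 > ... > b_r.\<close>
definition part_b :: "nat list \<Rightarrow> nat \<Rightarrow> nat" where
  "part_b lam i = remdups lam ! (i - 1)"

definition part_r :: "nat list \<Rightarrow> nat" where
  "part_r lam = length (remdups lam)"

definition part_d :: "nat list \<Rightarrow> nat \<Rightarrow> nat" where
  "part_d lam i = (if i = 0 then 0 else length (filter (\<lambda>x. x = part_b lam i) lam))"

text \<open>D j = d_0 + d_1 + ... + d_j\<close>
definition part_D :: "nat list \<Rightarrow> nat \<Rightarrow> nat" where
  "part_D lam j = (\<Sum>i\<le>j. part_d lam i)"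

text \<open>Valid enhancement indices q = d_0 + ... + d_{j-1}, 1 \<le> j \<le> r+1.\<close>
definition enh_index :: "nat list \<Rightarrow> nat \<Rightarrow> nat \<Rightarrow> bool" where
  "enh_index lam q j \<longleftrightarrow> 1 \<le> j \<and> j \<le> part_r lam + 1 \<and> q = part_D lam (j - 1)"

text \<open>Jordan basis {X^k v_i : 1 \<le> i \<le> t, 0 \<le> k \<le> a_i - 1} with X^{a_i} v_i = 0.\<close>
definition jordan_basis ::
  "(('k::field)^'n \<Rightarrow> 'k^'n) \<Rightarrow> nat list \<Rightarrow> (nat \<Rightarrow> 'k^'n) \<Rightarrow> bool" where
  "jordan_basis X lam v \<longleftrightarrow>
     (let I = {(i, k). 1 \<le> i \<and> i \<le> length lam \<and> k < part_a lam i};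
          f = (\<lambda>(i, k). (X ^^ k) (v i))
      in inj_on f I \<and> vec.independent (f ` I) \<and> vec.span (f ` I) = UNIV)
     \<and> (\<forall>i. 1 \<le> i \<and> i \<le> length lam \<longrightarrow> (X ^^ part_a lam i) (v i) = 0)"

text \<open>u_j = v_{d_1+...+d_j} for 1 \<le> j \<le> r, u_{r+1} = 0.\<close>
definition u_vec :: "nat list \<Rightarrow> (nat \<Rightarrow> 'k::field^'n) \<Rightarrow> nat \<Rightarrow> 'k^'n" where
  "u_vec lam v j = (if j \<le> part_r lam then v (part_D lam j) else 0)"

text \<open>Adjoint action of (g, y) \<in> G \<ltimes> V on (X, w) \<in> gl(V) \<times> V.\<close>
definition Ad_action ::
  "(('k::field)^'n \<Rightarrow> 'k^'n) \<Rightarrow> 'k^'n \<Rightarrow> ('k^'n \<Rightarrow> 'k^'n) \<Rightarrow> 'k^'n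
     \<Rightarrow> (('k^'n \<Rightarrow> 'k^'n) \<times> ('k^'n))" where
  "Ad_action g y X w = (g \<circ> X \<circ> inv g, - ((g \<circ> X \<circ> inv g) y) + g w)"

definition is_GL :: "(('k::field)^'n \<Rightarrow> 'k^'n) \<Rightarrow> bool" where
  "is_GL g \<longleftrightarrow> Vector_Spaces.linear (*s) (*s) g \<and> bij g"

text \<open>The enhanced nilpotent orbit O_{lambda[q]}: the orbit of (X0, u_j) where X0 is a
  nilpotent of type lambda with a Jordan basis v and q = d_0 + ... + d_{j-1}.\<close>
definition enh_orbit :: "nat list \<Rightarrow> nat \<Rightarrow> ((('k::field)^'n \<Rightarrow> 'k^'n) \<times> ('k^'n)) set" where
  "enh_orbit lam q = {Ad_action g y X0 (u_vec lam v j) | g y X0 v j.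
      is_GL g \<and> Vector_Spaces.linear (*s) (*s) X0 \<and> jordan_basis X0 lam v \<and> enh_index lam q j}"

text \<open>Enhanced number wp_k^{lambda[q]}.\<close>
definition enh_number :: "nat list \<Rightarrow> nat \<Rightarrow> nat \<Rightarrow> nat" where
  "enh_number lam q k = (\<Sum>i=1..k. part_a lam i) +
      (if k + 1 > q then part_a lam (k + 1) else part_a lam (k + 1) - 1)"

text \<open>k[X]u = span of u, Xu, X^2u, ...\<close>
definition kX :: "(('k::field)^'n \<Rightarrow> 'k^'n) \<Rightarrow> 'k^'n \<Rightarrow> ('k^'n) set" where
  "kX X u = vec.span (range (\<lambda>m. (X ^^ m) u))"

end

theory Submission
  imports Defs
begin

text \<open>
  Write X = g X0 g^-1 with X0 nilpotent in Jordan form and w = g u - X y, where u = u_j is a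
  Jordan basis vector v_p (or 0). Conjugation by g identifies the sets of dimensions for (X, w)
  and for (X0, u), so it suffices to treat the Jordan form.

  Upper bound: if M is generated by p vectors of an X-stable subspace W, every application of X
  lowers dim M by at most min p (the rank drop of X on W); the rank drops of a nilpotent of
  type lambda are the column lengths of its Young diagram, and summing gives a_1 + ... + a_p.
  When k < q, the k + 1 generators of X^m M, m = a_p, lie in im X^m and one of them has the
  form X y, which saves one more dimension.

  Lower bound: generators taken from the Jordan basis span whole Jordan blocks; when k < q the
  generator u + X v_(k+1) does so only after adjoining kX X u and v_(k+1), which costs at most
  a_p + 1 dimensions.
\<close>

lemma funpow_apply_add: "(f ^^ m) ((f ^^ n) x) = (f ^^ (m + n)) x"
  by (simp add: funpow_add)

lemma (in vector_space) linear_funpow: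
  assumes "Vector_Spaces.linear scale scale f"
  shows "Vector_Spaces.linear scale scale (f ^^ n)"
proof (induction n)
  case (Suc n)
  show ?case
    using Vector_Spaces.linear_compose[OF Suc assms] by (simp add: o_def)
qed (simp add: linear_id[unfolded id_def])

lemma sum_lessThan_add:
  fixes f :: "nat \<Rightarrow> 'a::comm_monoid_add"
  shows "(\<Sum>s<m + N. f s) = (\<Sum>s<m. f s) + (\<Sum>s<N. f (s + m))"
  by (induction N) (simp_all add: add_ac)

context finite_dimensional_vector_space
begin

lemma dim_Un_le_card:
  assumes "finite B"
  shows "dim (A \<union> B) \<le> dim A + card B"
  using assms
proof (induction B rule: finite_induct)
  case (insert x B)
  then show ?case by (simp add: dim_insert)
qed simp

lemma dim_Un_le: "dim (A \<union> B) \<le> dim A + dim B"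
proof -
  obtain C where "C \<subseteq> B" "independent C" "B \<subseteq> span C" "card C = dim B"
    using basis_exists by blast
  then have "A \<union> B \<subseteq> span (A \<union> C)"
    using span_mono[of C "A \<union> C"] span_superset[of "A \<union> C"] by blast
  then have "dim (A \<union> B) \<le> dim (A \<union> C)" by (rule dim_mono)
  also have "\<dots> \<le> dim A + card C"
    using dim_Un_le_card \<open>independent C\<close> finiteI_independent by blast
  finally show ?thesis using \<open>card C = dim B\<close> by simp
qed

text \<open>That is, dim S - dim (f ` S) \<le> dim T - dim (f ` T), without truncated subtraction.\<close>

lemma dim_image_loss_mono:
  assumes f: "Vector_Spaces.linear scale scale f" and "S \<subseteq> T"
  shows "dim (f ` T) + dim S \<le> dim (f ` S) + dim T"
proof -
  obtain B where B: "B \<subseteq> S" "independent B" "S \<subseteq> span B" "card B = dim S"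
    using basis_exists by blast
  obtain C where C: "B \<subseteq> C" "C \<subseteq> T" "independent C" "T \<subseteq> span C"
    using maximal_independent_subset_extend[of B T] B \<open>S \<subseteq> T\<close> by blast
  have "card C = dim T" using C basis_card_eq_dim by blast
  have "finite C" using C(3) finiteI_independent by blast
  interpret f: Vector_Spaces.linear scale scale f by (fact f)
  have "f ` T \<subseteq> f ` span C" using C(4) by blast
  also have "\<dots> = span (f ` B \<union> f ` (C - B))"
    using C(1) f.span_image by (metis Un_Diff_cancel image_Un sup.absorb_iff2)
  finally have "f ` T \<subseteq> span (f ` B \<union> f ` (C - B))" .
  then have "dim (f ` T) \<le> dim (f ` B \<union> f ` (C - B))" by (rule dim_mono)
  also have "\<dots> \<le> dim (f ` B) + card (f ` (C - B))"
    using \<open>finite C\<close> by (simp add: dim_Un_le_card)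
  also have "\<dots> \<le> dim (f ` S) + card (C - B)"
    using dim_subset[of "f ` B" "f ` S"] B(1) card_image_le[of "C - B" f] \<open>finite C\<close>
    by (simp add: add_mono image_mono)
  finally show ?thesis
    using \<open>card C = dim T\<close> B(4) card_Diff_subset[of B C] C(1) card_mono[OF \<open>finite C\<close> C(1)]
      finite_subset[OF C(1) \<open>finite C\<close>] by linarith
qed

end

section \<open>Cyclic subspaces\<close>

definition kX_span :: "('k::field^'n \<Rightarrow> 'k^'n) \<Rightarrow> ('k^'n) set \<Rightarrow> ('k^'n) set" where
  "kX_span X G = vec.span (\<Union>x\<in>G. kX X x)"

lemma funpow_in_kX: "(X ^^ m) x \<in> kX X x"
  unfolding kX_def by (meson rangeI vec.span_base)

lemma self_in_kX: "x \<in> kX X x"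
  using funpow_in_kX[where m = 0] by simp

lemma kX_least:
  assumes "vec.subspace W" "X ` W \<subseteq> W" "x \<in> W"
  shows "kX X x \<subseteq> W"
proof -
  have "(X ^^ m) x \<in> W" for m
    using assms(2,3) by (induction m) auto
  then show ?thesis
    unfolding kX_def using assms(1) by (intro vec.span_minimal) auto
qed

lemma kX_image_intertwine:
  fixes X Y L :: "'k::field^'n \<Rightarrow> 'k^'n"
  assumes L: "Vector_Spaces.linear (*s) (*s) L" and LX: "\<And>x. L (X x) = Y (L x)"
  shows "L ` kX X x = kX Y (L x)"
proof -
  have "L ((X ^^ m) x) = (Y ^^ m) (L x)" for m
    by (induction m) (simp_all add: LX)
  then have "L ` range (\<lambda>m. (X ^^ m) x) = range (\<lambda>m. (Y ^^ m) (L x))"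
    by (simp add: image_image)
  then show ?thesis
    unfolding kX_def vec.linear_span_image[OF L, symmetric] by simp
qed

lemma dim_kX_le:
  fixes X :: "'k::field^'n \<Rightarrow> 'k^'n"
  assumes X: "Vector_Spaces.linear (*s) (*s) X" and "(X ^^ m) u = 0"
  shows "vec.dim (kX X u) \<le> m"
proof -
  have "(X ^^ s) u \<in> vec.span ((\<lambda>s. (X ^^ s) u) ` {..<m})" for s
  proof (cases "s < m")
    case False
    then have "(X ^^ s) u = (X ^^ (s - m)) ((X ^^ m) u)"
      by (simp add: funpow_apply_add)
    then show ?thesis
      using assms(2) vec.linear_0[OF vec.linear_funpow[OF X]] vec.span_zero by simp
  qed (simp add: vec.span_base)
  then have "kX X u \<subseteq> vec.span ((\<lambda>s. (X ^^ s) u) ` {..<m})"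
    unfolding kX_def by (intro vec.span_minimal) auto
  then have "vec.dim (kX X u) \<le> card ((\<lambda>s. (X ^^ s) u) ` {..<m})"
    by (rule vec.dim_le_card) simp
  also have "\<dots> \<le> m"
    using card_image_le[of "{..<m}" "\<lambda>s. (X ^^ s) u"] by simp
  finally show ?thesis .
qed

lemma subspace_kX_span: "vec.subspace (kX_span X G)"
  unfolding kX_span_def by simp

lemma span_kX_span [simp]: "vec.span (kX_span X G) = kX_span X G"
  unfolding kX_span_def by simp

lemma kX_subset_kX_span: "x \<in> G \<Longrightarrow> kX X x \<subseteq> kX_span X G"
  unfolding kX_span_def by (meson UN_upper vec.span_superset subset_trans)

lemma in_kX_span: "x \<in> G \<Longrightarrow> x \<in> kX_span X G"
  using kX_subset_kX_span self_in_kX by blast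

lemma kX_span_mono: "G \<subseteq> H \<Longrightarrow> kX_span X G \<subseteq> kX_span X H"
  unfolding kX_span_def by (rule vec.span_mono) blast

lemma kX_span_least:
  assumes "vec.subspace W" "X ` W \<subseteq> W" "G \<subseteq> W"
  shows "kX_span X G \<subseteq> W"
  unfolding kX_span_def using assms kX_least[OF assms(1,2)]
  by (intro vec.span_minimal) auto

lemma kX_span_image_intertwine:
  fixes X Y L :: "'k::field^'n \<Rightarrow> 'k^'n"
  assumes L: "Vector_Spaces.linear (*s) (*s) L" and LX: "\<And>x. L (X x) = Y (L x)"
  shows "L ` kX_span X G = kX_span Y (L ` G)"
  unfolding kX_span_def vec.linear_span_image[OF L, symmetric] image_UN
  using kX_image_intertwine[of L X Y, OF L LX] by simp

lemma kX_stable: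
  fixes X :: "'k::field^'n \<Rightarrow> 'k^'n"
  assumes X: "Vector_Spaces.linear (*s) (*s) X"
  shows "X ` kX X x \<subseteq> kX X x"
proof -
  have "(X ^^ m) (X x) = (X ^^ Suc m) x" for m
    by (simp add: funpow_swap1)
  then have "range (\<lambda>m. (X ^^ m) (X x)) \<subseteq> range (\<lambda>m. (X ^^ m) x)"
    by (metis (no_types, lifting) image_subset_iff rangeI)
  then show ?thesis
    unfolding kX_image_intertwine[of X X X, OF X refl] unfolding kX_def by (rule vec.span_mono)
qed

lemma kX_span_stable:
  fixes X :: "'k::field^'n \<Rightarrow> 'k^'n"
  assumes X: "Vector_Spaces.linear (*s) (*s) X"
  shows "X ` kX_span X G \<subseteq> kX_span X G"
  unfolding kX_span_def vec.linear_span_image[OF X, symmetric] image_UN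
  using kX_stable[OF X] by (intro vec.span_mono) blast

lemma funpow_in_kX_span:
  fixes X :: "'k::field^'n \<Rightarrow> 'k^'n"
  assumes X: "Vector_Spaces.linear (*s) (*s) X" and "x \<in> kX_span X G"
  shows "(X ^^ j) x \<in> kX_span X G"
  using assms(2) kX_span_stable[OF X] by (induction j) auto

lemma funpow_image_kX_span:
  fixes X :: "'k::field^'n \<Rightarrow> 'k^'n"
  assumes X: "Vector_Spaces.linear (*s) (*s) X"
  shows "(X ^^ n) ` kX_span X G = kX_span X ((X ^^ n) ` G)"
  by (rule kX_span_image_intertwine[OF vec.linear_funpow[OF X]]) (simp add: funpow_swap1)

lemma kX_span_insert_0:
  fixes X :: "'k::field^'n \<Rightarrow> 'k^'n"
  assumes X: "Vector_Spaces.linear (*s) (*s) X"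
  shows "kX_span X (insert 0 G) = kX_span X G"
proof
  have "insert 0 G \<subseteq> kX_span X G"
    using in_kX_span vec.subspace_0[OF subspace_kX_span] by blast
  then show "kX_span X (insert 0 G) \<subseteq> kX_span X G"
    by (rule kX_span_least[OF subspace_kX_span kX_span_stable[OF X]])
qed (rule kX_span_mono, blast)

lemma dim_funpow_image_kX_span_le:
  fixes X :: "'k::field^'n \<Rightarrow> 'k^'n"
  assumes X: "Vector_Spaces.linear (*s) (*s) X" and "finite G"
  shows "vec.dim ((X ^^ h) ` kX_span X G) \<le> vec.dim ((X ^^ Suc h) ` kX_span X G) + card G"
proof -
  define M where "M = kX_span X G"
  define A where "A = (X ^^ Suc h) ` M \<union> (X ^^ h) ` G"
  have "X ` A \<subseteq> (X ^^ Suc h) ` M"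
  proof -
    have "X ((X ^^ Suc h) x) = (X ^^ Suc h) (X x)" for x
      by (rule funpow_swap1)
    moreover have "X ((X ^^ h) x) = (X ^^ Suc h) x" for x
      by simp
    moreover have "X ` M \<subseteq> M" unfolding M_def by (rule kX_span_stable[OF X])
    moreover have "G \<subseteq> M" unfolding M_def using in_kX_span by blast
    ultimately show ?thesis unfolding A_def by (auto simp del: funpow.simps)
  qed
  then have "X ` vec.span A \<subseteq> vec.span A"
    unfolding vec.linear_span_image[OF X, symmetric] A_def by (intro vec.span_mono) blast
  moreover have "(X ^^ h) ` G \<subseteq> vec.span A"
    unfolding A_def by (intro subset_trans[OF _ vec.span_superset]) blast
  ultimately have "(X ^^ h) ` M \<subseteq> vec.span A"
    unfolding M_def funpow_image_kX_span[OF X] by (intro kX_span_least) simp_all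
  then have "vec.dim ((X ^^ h) ` M) \<le> vec.dim A" by (rule vec.dim_mono)
  also have "\<dots> \<le> vec.dim ((X ^^ Suc h) ` M) + card ((X ^^ h) ` G)"
    unfolding A_def using \<open>finite G\<close> by (simp add: vec.dim_Un_le_card)
  also have "\<dots> \<le> vec.dim ((X ^^ Suc h) ` M) + card G"
    using card_image_le[OF \<open>finite G\<close>] by simp
  finally show ?thesis unfolding M_def .
qed

text \<open>
  Each application of X lowers the dimension by at most p, since kX_span X G is generated by
  p vectors, and by at most the rank drop of X on W, by dim_image_loss_mono.
\<close>

lemma dim_kX_span_le_sum_rank_drops:
  fixes X :: "'k::field^'n \<Rightarrow> 'k^'n"
  assumes X: "Vector_Spaces.linear (*s) (*s) X" and "finite G" "card G \<le> p"
    and W: "vec.subspace W" "X ` W \<subseteq> W" "G \<subseteq> W"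
  shows "vec.dim (kX_span X G) \<le> vec.dim ((X ^^ h) ` kX_span X G)
     + (\<Sum>s<h. min p (vec.dim ((X ^^ s) ` W) - vec.dim ((X ^^ Suc s) ` W)))"
proof (induction h)
  case (Suc h)
  let ?M = "kX_span X G"
  have "vec.dim ((X ^^ h) ` ?M) \<le> vec.dim ((X ^^ Suc h) ` ?M) + p"
    using dim_funpow_image_kX_span_le[OF X \<open>finite G\<close>, of h] \<open>card G \<le> p\<close> by linarith
  moreover have "vec.dim ((X ^^ h) ` ?M) + vec.dim ((X ^^ Suc h) ` W)
     \<le> vec.dim ((X ^^ Suc h) ` ?M) + vec.dim ((X ^^ h) ` W)"
    using vec.dim_image_loss_mono[OF X, of "(X ^^ h) ` ?M" "(X ^^ h) ` W"]
      kX_span_least[OF W] by (simp add: image_comp image_mono)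
  ultimately show ?case using Suc.IH by simp
qed simp

lemma kX_span_insert_shift:
  fixes X :: "'k::field^'n \<Rightarrow> 'k^'n"
  assumes X: "Vector_Spaces.linear (*s) (*s) X" and "(X ^^ N) y = 0"
    and "y \<in> kX_span X (insert (X y) B)"
  shows "y \<in> kX_span X B"
proof -
  \<comment> \<open>y lies in every Y (Suc n), and Y (Suc N) = kX_span X B.\<close>
  define Y where "Y n = kX_span X (insert ((X ^^ n) y) B)" for n
  have B_Y: "B \<subseteq> Y n" for n
    unfolding Y_def using in_kX_span by blast
  have step: "(X ^^ n) y \<in> Y (Suc n)" for n
  proof -
    have "(X ^^ n) y \<in> (X ^^ n) ` Y 1"
      using assms(3) by (simp add: Y_def)
    also have "\<dots> = kX_span X (insert ((X ^^ Suc n) y) ((X ^^ n) ` B))"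
      unfolding Y_def funpow_image_kX_span[OF X] by (simp add: funpow_swap1)
    also have "\<dots> \<subseteq> Y (Suc n)"
      unfolding Y_def
      by (rule kX_span_least[OF subspace_kX_span kX_span_stable[OF X]])
        (auto intro: in_kX_span funpow_in_kX_span[OF X])
    finally show ?thesis .
  qed
  have Y_mono: "Y n \<subseteq> Y (Suc n)" for n
    using step[of n] B_Y[of "Suc n"] unfolding Y_def
    by (intro kX_span_least[OF subspace_kX_span kX_span_stable[OF X]]) blast
  have "y \<in> Y (Suc n)" for n
  proof (induction n)
    case 0
    show ?case using assms(3) by (simp add: Y_def)
  next
    case (Suc n)
    then show ?case using Y_mono by blast
  qed
  moreover have "(X ^^ Suc N) y = 0"
    using assms(2) vec.linear_0[OF X] by simp
  ultimately show ?thesis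
    using kX_span_insert_0[OF X] by (metis Y_def)
qed

lemma kX_span_insert_image: "kX_span X (insert w (\<nu> ` A)) = vec.span (kX X w \<union> (\<Union>i\<in>A. kX X (\<nu> i)))"
  unfolding kX_span_def by simp

lemma dim_kX_span_conj:
  fixes g X :: "'k::field^'n \<Rightarrow> 'k^'n"
  assumes g: "Vector_Spaces.linear (*s) (*s) g" "bij g"
  shows "vec.dim (kX_span (g \<circ> X \<circ> inv g) (g ` G)) = vec.dim (kX_span X G)"
proof -
  have "g ` kX_span X G = kX_span (g \<circ> X \<circ> inv g) (g ` G)"
    using g by (intro kX_span_image_intertwine) (simp_all add: bij_is_inj)
  then show ?thesis
    using vec.dim_image_eq[OF g(1)] bij_is_inj[OF g(2)] by (metis inj_on_subset subset_UNIV)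
qed

lemma dims_kX_span_conj:
  fixes g X :: "'k::field^'n \<Rightarrow> 'k^'n"
  assumes g: "Vector_Spaces.linear (*s) (*s) g" "bij g"
  shows "{vec.dim (kX_span (g \<circ> X \<circ> inv g) (insert w' (\<nu> ` A))) | w' \<nu>. w' \<in> g ` W}
       = {vec.dim (kX_span X (insert w' (\<nu> ` A))) | w' \<nu>. w' \<in> W}"
proof -
  have g_inv: "g (inv g x) = x" for x
    using g(2) by (simp add: bij_is_surj surj_f_inv_f)
  have dim_eq: "vec.dim (kX_span (g \<circ> X \<circ> inv g) (insert (g w') ((\<lambda>i. g (\<nu> i)) ` A)))
      = vec.dim (kX_span X (insert w' (\<nu> ` A)))" for w' \<nu>
    using dim_kX_span_conj[OF g, of X "insert w' (\<nu> ` A)"] by (simp add: image_image)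
  show ?thesis
  proof (intro subset_antisym subsetI)
    fix d assume "d \<in> {vec.dim (kX_span (g \<circ> X \<circ> inv g) (insert w' (\<nu> ` A))) | w' \<nu>. w' \<in> g ` W}"
    then obtain w' \<nu> where "w' \<in> W"
      and "d = vec.dim (kX_span (g \<circ> X \<circ> inv g) (insert (g w') ((\<lambda>i. g (inv g (\<nu> i))) ` A)))"
      using g_inv by auto
    then show "d \<in> {vec.dim (kX_span X (insert w' (\<nu> ` A))) | w' \<nu>. w' \<in> W}"
      unfolding dim_eq by blast
  next
    fix d assume "d \<in> {vec.dim (kX_span X (insert w' (\<nu> ` A))) | w' \<nu>. w' \<in> W}"
    then obtain w' \<nu> where "w' \<in> W" "d = vec.dim (kX_span X (insert w' (\<nu> ` A)))"
      by blast
    then have "g w' \<in> g ` W"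
      and "d = vec.dim (kX_span (g \<circ> X \<circ> inv g) (insert (g w') ((\<lambda>i. g (\<nu> i)) ` A)))"
      unfolding dim_eq by simp_all
    then show "d \<in> {vec.dim (kX_span (g \<circ> X \<circ> inv g) (insert w' (\<nu> ` A))) | w' \<nu>. w' \<in> g ` W}"
      by (intro CollectI exI[of _ "g w'"] exI[of _ "\<lambda>i. g (\<nu> i)"]) simp
  qed
qed

section \<open>Partitions\<close>

definition parts_gt :: "nat list \<Rightarrow> nat \<Rightarrow> nat" where
  "parts_gt lam s = card {i\<in>{1..length lam}. s < part_a lam i}"

lemma parts_gt_le_length: "parts_gt lam s \<le> length lam"
proof -
  have "card {i\<in>{1..length lam}. s < part_a lam i} \<le> card {1..length lam}"
    by (rule card_mono) auto
  then show ?thesis unfolding parts_gt_def by simp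
qed

lemma card_part_a_filter:
  "card {i\<in>{1..length lam}. P (part_a lam i)} = length (filter P lam)"
proof -
  have "{i\<in>{1..length lam}. P (part_a lam i)} = Suc ` {i. i < length lam \<and> P (lam ! i)}"
  proof (rule set_eqI)
    fix i
    show "i \<in> {i\<in>{1..length lam}. P (part_a lam i)} \<longleftrightarrow> i \<in> Suc ` {i. i < length lam \<and> P (lam ! i)}"
      unfolding part_a_def by (cases i) auto
  qed
  then show ?thesis
    by (simp add: card_image length_filter_conv_card)
qed

lemma part_D_eq_card:
  assumes "j \<le> part_r lam"
  shows "part_D lam j = card {i\<in>{1..length lam}. part_a lam i \<in> part_b lam ` {1..j}}"
proof -
  have inj: "inj_on (part_b lam) {1..j}"
  proof (rule inj_onI)
    fix l l' assume l: "l \<in> {1..j}" "l' \<in> {1..j}" and "part_b lam l = part_b lam l'"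
    moreover have "l - 1 < length (remdups lam)" "l' - 1 < length (remdups lam)"
      using l assms unfolding part_r_def by auto
    ultimately show "l = l'"
      using nth_eq_iff_index_eq[OF distinct_remdups, of "l - 1" lam "l' - 1"]
      unfolding part_b_def by auto
  qed
  have "part_D lam j = (\<Sum>l\<in>{1..j}. part_d lam l)"
    unfolding part_D_def atMost_atLeast0 by (simp add: sum.atLeast_Suc_atMost part_d_def)
  also have "\<dots> = (\<Sum>l\<in>{1..j}. card {i\<in>{1..length lam}. part_a lam i = part_b lam l})"
  proof (rule sum.cong[OF refl])
    fix l assume "l \<in> {1..j}"
    then show "part_d lam l = card {i\<in>{1..length lam}. part_a lam i = part_b lam l}"
      unfolding part_d_def card_part_a_filter[where P = "\<lambda>x. x = part_b lam l"] by simp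
  qed
  also have "\<dots> = card (\<Union>l\<in>{1..j}. {i\<in>{1..length lam}. part_a lam i = part_b lam l})"
  proof (rule card_UN_disjoint[symmetric])
    show "\<forall>l\<in>{1..j}. \<forall>l'\<in>{1..j}. l \<noteq> l' \<longrightarrow>
        {i\<in>{1..length lam}. part_a lam i = part_b lam l} \<inter>
        {i\<in>{1..length lam}. part_a lam i = part_b lam l'} = {}"
    proof (intro ballI impI)
      fix l l' assume "l \<in> {1..j}" "l' \<in> {1..j}" "l \<noteq> l'"
      then have "part_b lam l \<noteq> part_b lam l'"
        using inj_onD[OF inj] by blast
      then show "{i\<in>{1..length lam}. part_a lam i = part_b lam l} \<inter>
          {i\<in>{1..length lam}. part_a lam i = part_b lam l'} = {}"
        by auto
    qed
  qed simp_all
  also have "(\<Union>l\<in>{1..j}. {i\<in>{1..length lam}. part_a lam i = part_b lam l})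
      = {i\<in>{1..length lam}. part_a lam i \<in> part_b lam ` {1..j}}"
    by blast
  finally show ?thesis .
qed

lemma part_b_cases:
  assumes "x \<in> set lam"
  obtains l where "1 \<le> l" "l \<le> part_r lam" "x = part_b lam l"
proof -
  obtain l where "l < length (remdups lam)" "remdups lam ! l = x"
    using assms by (metis in_set_conv_nth set_remdups)
  then show ?thesis
    using that[of "Suc l"] unfolding part_b_def part_r_def by simp
qed

lemma part_b_in_set: "1 \<le> j \<Longrightarrow> j \<le> part_r lam \<Longrightarrow> part_b lam j \<in> set lam"
  using nth_mem[of "j - 1" "remdups lam"] unfolding part_b_def part_r_def by simp

lemma part_D_r: "part_D lam (part_r lam) = length lam"
proof -
  have "part_b lam ` {1..part_r lam} = set lam"
    using part_b_in_set by (auto elim!: part_b_cases)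
  then have "{i\<in>{1..length lam}. part_a lam i \<in> part_b lam ` {1..part_r lam}} = {1..length lam}"
    unfolding part_a_def by auto
  then show ?thesis
    by (simp add: part_D_eq_card)
qed

locale nat_partition =
  fixes lam :: "nat list" and n :: nat
  assumes is_partition: "is_partition_of lam n"
begin

lemma part_a_pos_iff: "0 < part_a lam i \<longleftrightarrow> 1 \<le> i \<and> i \<le> length lam"
  using is_partition unfolding is_partition_of_def part_a_def by auto

lemma part_a_antimono:
  assumes "1 \<le> i" "i \<le> j"
  shows "part_a lam j \<le> part_a lam i"
proof (cases "i < j \<and> j \<le> length lam")
  case True
  then show ?thesis
    using is_partition sorted_wrt_nth_less[of "(\<ge>)" lam "i - 1" "j - 1"] assms
    unfolding is_partition_of_def part_a_def by auto
next
  case False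
  then show ?thesis
    using assms part_a_pos_iff[of j] by (cases "i = j") auto
qed

lemma sum_part_a: "(\<Sum>i=1..length lam. part_a lam i) = n"
proof -
  have "n = (\<Sum>i<length lam. lam ! i)"
    using is_partition unfolding is_partition_of_def by (simp add: sum_list_sum_nth atLeast0LessThan)
  also have "\<dots> = (\<Sum>i=1..length lam. part_a lam i)"
    unfolding part_a_def
    by (rule sum.reindex_bij_witness[of _ "\<lambda>i. i - 1" Suc]) auto
  finally show ?thesis by simp
qed

lemma part_a_le: "part_a lam i \<le> n"
  using member_le_sum[of i "{1..length lam}" "part_a lam"] sum_part_a part_a_pos_iff[of i]
  by (cases "1 \<le> i \<and> i \<le> length lam") auto

lemma le_parts_gt_iff:
  assumes "1 \<le> p"
  shows "p \<le> parts_gt lam s \<longleftrightarrow> s < part_a lam p"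
proof
  assume "s < part_a lam p"
  have "{1..p} \<subseteq> {i\<in>{1..length lam}. s < part_a lam i}"
  proof
    fix i assume i: "i \<in> {1..p}"
    then have "s < part_a lam i"
      using part_a_antimono[of i p] \<open>s < part_a lam p\<close> by auto
    then show "i \<in> {i\<in>{1..length lam}. s < part_a lam i}"
      using part_a_pos_iff[of i] by auto
  qed
  then have "card {1..p} \<le> parts_gt lam s"
    unfolding parts_gt_def by (intro card_mono) auto
  then show "p \<le> parts_gt lam s" by simp
next
  assume "p \<le> parts_gt lam s"
  show "s < part_a lam p"
  proof (rule ccontr)
    assume "\<not> s < part_a lam p"
    have "{i\<in>{1..length lam}. s < part_a lam i} \<subseteq> {1..p - 1}"
    proof
      fix i assume i: "i \<in> {i\<in>{1..length lam}. s < part_a lam i}"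
      then have "\<not> p \<le> i"
        using part_a_antimono[OF assms, of i] \<open>\<not> s < part_a lam p\<close> by auto
      then show "i \<in> {1..p - 1}" using i by auto
    qed
    then have "parts_gt lam s \<le> card {1..p - 1}"
      unfolding parts_gt_def by (intro card_mono) auto
    then show False using \<open>p \<le> parts_gt lam s\<close> assms by simp
  qed
qed

lemma parts_gt_0: "parts_gt lam 0 = length lam"
proof -
  have "{i\<in>{1..length lam}. 0 < part_a lam i} = {1..length lam}"
    using part_a_pos_iff by auto
  then show ?thesis unfolding parts_gt_def by simp
qed

text \<open>Counting the boxes of the Young diagram by columns instead of rows.\<close>

lemma sum_min_parts_gt:
  assumes "n \<le> N"
  shows "(\<Sum>s<N. min p (parts_gt lam s)) = (\<Sum>i=1..p. part_a lam i)"
proof -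
  have card_eq: "card {x\<in>A. P x} = (\<Sum>x\<in>A. if P x then 1 else 0)" if "finite A"
    for A :: "nat set" and P
    using sum.inter_filter[OF that, of "\<lambda>_. 1 :: nat" P] by simp
  have "min p (parts_gt lam s) = card {i\<in>{1..p}. s < part_a lam i}" for s
  proof -
    have "{i\<in>{1..p}. s < part_a lam i} = {1..min p (parts_gt lam s)}"
      using le_parts_gt_iff by auto
    then show ?thesis by simp
  qed
  then have "(\<Sum>s<N. min p (parts_gt lam s)) = (\<Sum>s<N. \<Sum>i=1..p. if s < part_a lam i then 1 else 0)"
    by (simp only: card_eq[OF finite_atLeastAtMost])
  also have "\<dots> = (\<Sum>i=1..p. \<Sum>s<N. if s < part_a lam i then 1 else 0)"
    by (rule sum.swap)
  also have "\<dots> = (\<Sum>i=1..p. part_a lam i)"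
  proof (rule sum.cong[OF refl])
    fix i
    have "{s\<in>{..<N}. s < part_a lam i} = {..<part_a lam i}"
      using part_a_le[of i] assms by auto
    then show "(\<Sum>s<N. if s < part_a lam i then 1 else 0) = part_a lam i"
      using card_eq[of "{..<N}" "\<lambda>s. s < part_a lam i"] by simp
  qed
  finally show ?thesis .
qed

lemma part_b_less_iff:
  assumes "1 \<le> i" "i \<le> part_r lam" "1 \<le> j" "j \<le> part_r lam"
  shows "part_b lam j < part_b lam i \<longleftrightarrow> i < j"
proof -
  have "sorted_wrt (\<ge>) lam"
    using is_partition unfolding is_partition_of_def by simp
  then have strict: "sorted_wrt (>) (remdups lam)"
    by (induction lam) (auto simp: order.strict_iff_order)
  have less: "part_b lam j < part_b lam i" if "1 \<le> i" "i < j" "j \<le> part_r lam" for i j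
  proof -
    have "i - 1 < j - 1" "j - 1 < length (remdups lam)"
      using that unfolding part_r_def by auto
    then show ?thesis
      using sorted_wrt_nth_less[OF strict] unfolding part_b_def by blast
  qed
  show ?thesis
    using less[of i j] less[of j i] assms by (cases i j rule: linorder_cases) auto
qed

lemma part_a_in_part_b_image:
  assumes "1 \<le> j" "j \<le> part_r lam" "1 \<le> i" "i \<le> length lam"
  shows "part_a lam i \<in> part_b lam ` {1..j} \<longleftrightarrow> part_b lam j \<le> part_a lam i"
    and "part_a lam i \<in> part_b lam ` {1..j - 1} \<longleftrightarrow> part_b lam j < part_a lam i"
proof -
  have "part_a lam i \<in> set lam"
    using assms(3,4) unfolding part_a_def by simp
  then obtain l where l: "1 \<le> l" "l \<le> part_r lam" "part_a lam i = part_b lam l"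
    by (rule part_b_cases)
  have inj: "part_b lam l = part_b lam l' \<longleftrightarrow> l = l'" if "1 \<le> l'" "l' \<le> part_r lam" for l'
    using part_b_less_iff[OF l(1,2) that] part_b_less_iff[OF that l(1,2)]
    by (cases l l' rule: linorder_cases) auto
  have mem: "part_a lam i \<in> part_b lam ` {1..j'} \<longleftrightarrow> l \<le> j'" if "j' \<le> part_r lam" for j'
  proof
    assume "part_a lam i \<in> part_b lam ` {1..j'}"
    then obtain l' where "l' \<in> {1..j'}" "part_b lam l = part_b lam l'"
      using l(3) by auto
    then show "l \<le> j'" using inj[of l'] that by auto
  next
    assume "l \<le> j'"
    then show "part_a lam i \<in> part_b lam ` {1..j'}" using l by auto
  qed
  show "part_a lam i \<in> part_b lam ` {1..j} \<longleftrightarrow> part_b lam j \<le> part_a lam i"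
    using mem[OF assms(2)] part_b_less_iff[OF assms(1,2) l(1,2)] l(3) by auto
  show "part_a lam i \<in> part_b lam ` {1..j - 1} \<longleftrightarrow> part_b lam j < part_a lam i"
    using mem[of "j - 1"] assms(1,2) part_b_less_iff[OF l(1,2) assms(1,2)] l(3) by auto
qed

lemma part_D_pred_eq:
  assumes "1 \<le> j" "j \<le> part_r lam"
  shows "part_D lam (j - 1) = parts_gt lam (part_b lam j)"
  using part_D_eq_card[of "j - 1" lam] part_a_in_part_b_image(2)[OF assms] assms
  unfolding parts_gt_def by (auto intro!: arg_cong[where f = card])

lemma part_D_eq:
  assumes "1 \<le> j" "j \<le> part_r lam"
  shows "part_D lam j = parts_gt lam (part_b lam j - 1)"
proof -
  have "0 < part_b lam j"
    using part_b_in_set[OF assms] is_partition unfolding is_partition_of_def by simp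
  have "{i\<in>{1..length lam}. part_a lam i \<in> part_b lam ` {1..j}}
      = {i\<in>{1..length lam}. part_b lam j - 1 < part_a lam i}"
  proof (intro Collect_cong conj_cong refl)
    fix i assume "i \<in> {1..length lam}"
    then have "part_a lam i \<in> part_b lam ` {1..j} \<longleftrightarrow> part_b lam j \<le> part_a lam i"
      by (intro part_a_in_part_b_image(1)[OF assms]) auto
    moreover have "part_b lam j \<le> part_a lam i \<longleftrightarrow> part_b lam j - 1 < part_a lam i"
      using \<open>0 < part_b lam j\<close> by arith
    ultimately show "part_a lam i \<in> part_b lam ` {1..j} \<longleftrightarrow> part_b lam j - 1 < part_a lam i"
      by blast
  qed
  then show ?thesis
    unfolding parts_gt_def part_D_eq_card[OF assms(2)] by simp
qed

text \<open>The last part of size b_j has index d_1 + ... + d_j.\<close>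

lemma part_a_part_D:
  assumes "1 \<le> j" "j \<le> part_r lam"
  shows "part_D lam (j - 1) < part_D lam j" "part_D lam j \<le> length lam"
    and "part_a lam (part_D lam j) = part_b lam j"
proof -
  define b where "b = part_b lam j"
  have q: "part_D lam (j - 1) = parts_gt lam b" and p: "part_D lam j = parts_gt lam (b - 1)"
    using part_D_pred_eq[OF assms] part_D_eq[OF assms] unfolding b_def by auto
  obtain i where i: "1 \<le> i" "i \<le> length lam" "part_a lam i = b"
    using part_b_in_set[OF assms] unfolding b_def part_a_def in_set_conv_nth
    by (metis Suc_leI diff_Suc_1 le_add1 plus_1_eq_Suc zero_less_Suc)
  have "0 < b"
    using i part_a_pos_iff by auto
  have "parts_gt lam b < i"
    using le_parts_gt_iff[OF i(1), of b] i(3) by simp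
  then have "b - 1 < part_a lam (Suc (parts_gt lam b))"
    using part_a_antimono[of "Suc (parts_gt lam b)" i] i \<open>0 < b\<close> by simp
  then show "part_D lam (j - 1) < part_D lam j"
    using le_parts_gt_iff[of "Suc (parts_gt lam b)" "b - 1"] p q by simp
  then show "part_a lam (part_D lam j) = part_b lam j"
    using le_parts_gt_iff[of "part_D lam j" "b - 1"] le_parts_gt_iff[of "part_D lam j" b] p q
      \<open>0 < b\<close> unfolding b_def by simp
  show "part_D lam j \<le> length lam"
    unfolding p by (rule parts_gt_le_length)
qed

lemma enh_index_witness:
  assumes "enh_index lam q j"
  obtains p where "q < p" "q = parts_gt lam (part_a lam p)"
    and "u_vec lam v j = (if p \<le> length lam then v p else 0)"
proof (cases "j = part_r lam + 1")
  case True
  \<comment> \<open>Here u_j = 0, represented by the empty part p = t + 1.\<close>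
  then have "q = length lam"
    using assms part_D_r unfolding enh_index_def by simp
  then show ?thesis
    using that[of "Suc (length lam)"] True parts_gt_0 unfolding u_vec_def part_a_def by simp
next
  case False
  then have j: "1 \<le> j" "j \<le> part_r lam"
    using assms unfolding enh_index_def by auto
  then have "q = parts_gt lam (part_a lam (part_D lam j))"
    using assms part_D_pred_eq[OF j] part_a_part_D(3)[OF j] unfolding enh_index_def by simp
  then show ?thesis
    using that[of "part_D lam j"] assms part_a_part_D(1,2)[OF j] j
    unfolding enh_index_def u_vec_def by simp
qed

end

section \<open>Nilpotent endomorphisms of a given Jordan type\<close>

lemma skip_index_surj:
  assumes "i \<in> (if p \<le> Suc k then {1..Suc k} else insert p {1..k})" "i \<noteq> p" "1 \<le> p"
  shows "\<exists>l\<in>{1..k}. (if l < p then l else Suc l) = i"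
proof (cases "i < p")
  case True
  then show ?thesis
    using assms by (intro bexI[of _ i]) (auto split: if_splits)
next
  case False
  then show ?thesis
    using assms by (intro bexI[of _ "i - 1"]) (auto split: if_splits)
qed

locale jordan_nilpotent = nat_partition lam "CARD('n)" for lam +
  fixes X :: "'k::field^'n \<Rightarrow> 'k^'n" and v :: "nat \<Rightarrow> 'k^'n"
  assumes linear_X: "Vector_Spaces.linear (*s) (*s) X"
    and jordan_basis_v: "jordan_basis X lam v"
begin

definition jordan_index :: "(nat \<times> nat) set" where
  "jordan_index = {(i, k). 1 \<le> i \<and> i \<le> length lam \<and> k < part_a lam i}"

definition jordan_vec :: "nat \<times> nat \<Rightarrow> 'k^'n" where
  "jordan_vec = (\<lambda>(i, k). (X ^^ k) (v i))"

lemma jordan_vec_basis: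
  "inj_on jordan_vec jordan_index" "vec.independent (jordan_vec ` jordan_index)"
  "vec.span (jordan_vec ` jordan_index) = UNIV"
  using jordan_basis_v unfolding jordan_basis_def jordan_index_def jordan_vec_def Let_def by auto

lemma funpow_v_eq_0:
  assumes "1 \<le> i" "i \<le> length lam" "part_a lam i \<le> m"
  shows "(X ^^ m) (v i) = 0"
proof -
  have "(X ^^ m) (v i) = (X ^^ (m - part_a lam i)) ((X ^^ part_a lam i) (v i))"
    using assms(3) by (simp add: funpow_apply_add)
  also have "\<dots> = 0"
    using jordan_basis_v assms(1,2) vec.linear_0[OF vec.linear_funpow[OF linear_X]]
    unfolding jordan_basis_def by simp
  finally show ?thesis .
qed

lemma card_le_dim:
  assumes "J \<subseteq> jordan_index" "jordan_vec ` J \<subseteq> vec.span S"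
  shows "card J \<le> vec.dim S"
proof -
  have "vec.independent (jordan_vec ` J)"
    using vec.independent_mono[OF jordan_vec_basis(2)] assms(1) by blast
  then have "card (jordan_vec ` J) \<le> vec.dim S"
    using vec.independent_card_le_dim[OF assms(2)] by simp
  then show ?thesis
    using card_image[OF inj_on_subset[OF jordan_vec_basis(1) assms(1)]] by simp
qed

lemma sum_part_a_le_dim:
  assumes "finite I" "0 \<notin> I"
    and "\<And>i s. i \<in> I \<Longrightarrow> s < part_a lam i \<Longrightarrow> (X ^^ s) (v i) \<in> vec.span S"
  shows "(\<Sum>i\<in>I. part_a lam i) \<le> vec.dim S"
proof -
  let ?J = "Sigma I (\<lambda>i. {..<part_a lam i})"
  have "?J \<subseteq> jordan_index"
    using assms(2) part_a_pos_iff unfolding jordan_index_def by fastforce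
  moreover have "jordan_vec ` ?J \<subseteq> vec.span S"
    using assms(3) unfolding jordan_vec_def by auto
  ultimately have "card ?J \<le> vec.dim S" by (rule card_le_dim)
  then show ?thesis
    using assms(1) by (simp add: card_SigmaI)
qed

lemma range_funpow:
  "range (X ^^ s) = vec.span (jordan_vec ` {(i, k) \<in> jordan_index. s \<le> k})"
proof -
  let ?B = "jordan_vec ` jordan_index" and ?J = "{(i, k) \<in> jordan_index. s \<le> k}"
  have "(X ^^ s) (jordan_vec (i, k)) \<in> insert 0 (jordan_vec ` ?J)"
    if ik: "(i, k) \<in> jordan_index" for i k
  proof (cases "s + k < part_a lam i")
    case True
    then have "jordan_vec (i, s + k) \<in> jordan_vec ` ?J"
      using ik unfolding jordan_index_def by auto
    then show ?thesis by (simp add: jordan_vec_def funpow_apply_add)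
  next
    case False
    then show ?thesis
      using ik funpow_v_eq_0[of i "s + k"]
      unfolding jordan_index_def by (simp add: jordan_vec_def funpow_apply_add)
  qed
  then have "(X ^^ s) ` ?B \<subseteq> insert 0 (jordan_vec ` ?J)" by auto
  moreover have "jordan_vec ` ?J \<subseteq> (X ^^ s) ` ?B"
  proof clarify
    fix i k assume "(i, k) \<in> jordan_index" "s \<le> k"
    then have "(i, k - s) \<in> jordan_index" "jordan_vec (i, k) = (X ^^ s) (jordan_vec (i, k - s))"
      by (auto simp: jordan_index_def jordan_vec_def funpow_apply_add)
    then show "jordan_vec (i, k) \<in> (X ^^ s) ` ?B" by blast
  qed
  ultimately have "vec.span ((X ^^ s) ` ?B) = vec.span (jordan_vec ` ?J)"
    using vec.span_mono[of "(X ^^ s) ` ?B" "insert 0 (jordan_vec ` ?J)"]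
      vec.span_mono[of "jordan_vec ` ?J" "(X ^^ s) ` ?B"] by simp
  then show ?thesis
    using vec.linear_span_image[OF vec.linear_funpow[OF linear_X], where S = ?B] jordan_vec_basis(3)
    by simp
qed

lemma nilpotent:
  assumes "CARD('n) \<le> N"
  shows "(X ^^ N) x = 0"
proof -
  have "\<not> N \<le> k" if "k < part_a lam i" for i k
    using part_a_le[of i] assms that by linarith
  then have empty: "{(i, k) \<in> jordan_index. N \<le> k} = {}"
    unfolding jordan_index_def by auto
  have "range (X ^^ N) = {0}"
    unfolding range_funpow empty by simp
  then show ?thesis by blast
qed

lemma dim_range_funpow: "vec.dim (range (X ^^ s)) = (\<Sum>i=1..length lam. part_a lam i - s)"
proof -
  let ?J = "{(i, k) \<in> jordan_index. s \<le> k}"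
  have sub: "?J \<subseteq> jordan_index" by blast
  have "vec.dim (range (X ^^ s)) = card (jordan_vec ` ?J)"
    unfolding range_funpow
    by (rule vec.dim_span_eq_card_independent[OF vec.independent_mono[OF jordan_vec_basis(2)]])
      (rule image_mono[OF sub])
  also have "\<dots> = card ?J"
    by (rule card_image[OF inj_on_subset[OF jordan_vec_basis(1) sub]])
  also have "?J = Sigma {1..length lam} (\<lambda>i. {s..<part_a lam i})"
    unfolding jordan_index_def by auto
  finally show ?thesis by (simp add: card_SigmaI)
qed

lemma rank_drop: "vec.dim (range (X ^^ s)) - vec.dim (range (X ^^ Suc s)) = parts_gt lam s"
proof -
  have "part_a lam i - s = (part_a lam i - Suc s) + (if s < part_a lam i then 1 else 0)" for i
    by auto
  then have "(\<Sum>i=1..length lam. part_a lam i - s)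
      = (\<Sum>i=1..length lam. part_a lam i - Suc s) + (\<Sum>i=1..length lam. if s < part_a lam i then 1 else 0)"
    by (simp add: sum.distrib)
  also have "(\<Sum>i=1..length lam. if s < part_a lam i then 1 else 0) = parts_gt lam s"
    unfolding parts_gt_def using sum.inter_filter[of "{1..length lam}" "\<lambda>_. 1 :: nat"] by simp
  finally show ?thesis
    unfolding dim_range_funpow by simp
qed

lemma dim_kX_span_le_in_range:
  assumes "finite G" "card G \<le> p" "G \<subseteq> range (X ^^ m)"
  shows "vec.dim (kX_span X G) \<le> (\<Sum>s<CARD('n). min p (parts_gt lam (s + m)))"
proof -
  let ?W = "range (X ^^ m)"
  have W: "vec.subspace ?W" "X ` ?W \<subseteq> ?W"
    by (simp add: range_funpow) (auto simp: funpow_swap1)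
  have "vec.dim (kX_span X G) \<le> vec.dim ((X ^^ CARD('n)) ` kX_span X G)
      + (\<Sum>s<CARD('n). min p (vec.dim ((X ^^ s) ` ?W) - vec.dim ((X ^^ Suc s) ` ?W)))"
    by (rule dim_kX_span_le_sum_rank_drops[OF linear_X assms(1,2) W assms(3)])
  moreover have "(X ^^ CARD('n)) ` kX_span X G \<subseteq> {0}"
    using nilpotent by auto
  then have "vec.dim ((X ^^ CARD('n)) ` kX_span X G) = 0"
    using vec.dim_subset[of _ "{0}"] by fastforce
  moreover have "vec.dim ((X ^^ s) ` ?W) - vec.dim ((X ^^ Suc s) ` ?W) = parts_gt lam (s + m)" for s
  proof -
    have "(X ^^ j) ` ?W = range (X ^^ (j + m))" for j
      by (simp add: image_comp funpow_add)
    then show ?thesis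
      using rank_drop[of "s + m"] by (simp only: add_Suc)
  qed
  ultimately show ?thesis by simp
qed

lemma dim_kX_span_le_sum_part_a:
  assumes "finite G" "card G \<le> p"
  shows "vec.dim (kX_span X G) \<le> (\<Sum>i=1..p. part_a lam i)"
  using dim_kX_span_le_in_range[OF assms, of 0] sum_min_parts_gt[of "CARD('n)" p] by simp

lemma dim_kX_span_insert_X_less:
  assumes "y \<in> range (X ^^ m)" "B \<subseteq> range (X ^^ m)" "finite B" "card B \<le> k"
    and "k < parts_gt lam m"
  shows "vec.dim (kX_span X (insert (X y) B)) < (\<Sum>s<CARD('n). min (Suc k) (parts_gt lam (s + m)))"
proof -
  let ?bound = "\<lambda>p. \<Sum>s<CARD('n). min p (parts_gt lam (s + m))"
  have "?bound k < ?bound (Suc k)"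
    by (rule sum_strict_mono_ex1) (use assms(5) in \<open>auto intro!: bexI[of _ 0]\<close>)
  have stable: "kX_span X (insert (X y) B) \<subseteq> kX_span X H" if "y \<in> kX_span X H" "B \<subseteq> H" for H
    using that in_kX_span kX_span_stable[OF linear_X]
    by (intro kX_span_least[OF subspace_kX_span kX_span_stable[OF linear_X]]) blast
  \<comment> \<open>Either y already lies in kX_span X B, which needs only k generators, or adjoining y
    strictly enlarges the module.\<close>
  show ?thesis
  proof (cases "y \<in> kX_span X (insert (X y) B)")
    case True
    then have "y \<in> kX_span X B"
      by (rule kX_span_insert_shift[OF linear_X nilpotent[OF order_refl]])
    then have "vec.dim (kX_span X (insert (X y) B)) \<le> vec.dim (kX_span X B)"
      using stable[of B] by (simp add: vec.dim_subset)
    also have "\<dots> \<le> ?bound k"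
      by (rule dim_kX_span_le_in_range[OF assms(3,4,2)])
    finally show ?thesis using \<open>?bound k < ?bound (Suc k)\<close> by linarith
  next
    case False
    then have "kX_span X (insert (X y) B) \<subset> kX_span X (insert y B)"
      using stable[of "insert y B"] in_kX_span[of y "insert y B"] by blast
    then have "vec.dim (kX_span X (insert (X y) B)) < vec.dim (kX_span X (insert y B))"
      using vec.dim_psubset by (metis span_kX_span)
    also have "\<dots> \<le> ?bound (Suc k)"
      using assms by (intro dim_kX_span_le_in_range) (auto simp: card_insert_if)
    finally show ?thesis .
  qed
qed

lemma dim_kX_span_le_enh_number:
  assumes "q = parts_gt lam m" "(X ^^ m) u = 0"
  shows "vec.dim (kX_span X (insert (u + X z) (\<nu> ` {1..k}))) \<le> enh_number lam q k"
proof -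
  define G where "G = insert (u + X z) (\<nu> ` {1..k})"
  have "finite G" unfolding G_def by simp
  have "card G \<le> Suc k"
    using card_image_le[of "{1..k}" \<nu>] unfolding G_def by (simp add: card_insert_if)
  show ?thesis
  proof (cases "q < Suc k")
    case True
    then show ?thesis
      using dim_kX_span_le_sum_part_a[OF \<open>finite G\<close> \<open>card G \<le> Suc k\<close>]
      unfolding enh_number_def G_def by simp
  next
    case False
    let ?f = "\<lambda>s. min (Suc k) (parts_gt lam s)"
    have Xm: "Vector_Spaces.linear (*s) (*s) (X ^^ m)"
      by (rule vec.linear_funpow[OF linear_X])
    have "vec.dim (kX_span X G) \<le> vec.dim ((X ^^ m) ` kX_span X G) + (\<Sum>s<m. ?f s)"
      using dim_kX_span_le_sum_rank_drops[OF linear_X \<open>finite G\<close> \<open>card G \<le> Suc k\<close>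
          vec.subspace_UNIV, of m] rank_drop by simp
    moreover have "(X ^^ m) ` kX_span X G
        = kX_span X (insert (X ((X ^^ m) z)) ((X ^^ m) ` \<nu> ` {1..k}))"
      unfolding G_def funpow_image_kX_span[OF linear_X]
      using assms(2) by (simp add: vec.linear_add[OF Xm] funpow_swap1)
    moreover have "vec.dim (kX_span X (insert (X ((X ^^ m) z)) ((X ^^ m) ` \<nu> ` {1..k})))
        < (\<Sum>s<CARD('n). ?f (s + m))"
      using False assms(1) card_image_le[of "\<nu> ` {1..k}" "X ^^ m"] card_image_le[of "{1..k}" \<nu>]
      by (intro dim_kX_span_insert_X_less) auto
    moreover have "(\<Sum>s<m. ?f s) + (\<Sum>s<CARD('n). ?f (s + m)) = (\<Sum>i=1..Suc k. part_a lam i)"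
      using sum_lessThan_add[of ?f m "CARD('n)"] sum_min_parts_gt[of "m + CARD('n)" "Suc k"] by simp
    ultimately show ?thesis
      using False unfolding enh_number_def G_def by simp
  qed
qed

text \<open>
  In the following, the enhancing vector u is v_p for a part index p, or 0 when p exceeds
  length lam (see enh_index_witness).
\<close>

lemma funpow_u_eq:
  assumes "u = (if p \<le> length lam then v p else 0)" "s < part_a lam p"
  shows "(X ^^ s) u = (X ^^ s) (v p)"
  using assms part_a_pos_iff[of p] by auto

lemma funpow_part_a_eq_0:
  assumes "1 \<le> p" "u = (if p \<le> length lam then v p else 0)"
  shows "(X ^^ part_a lam p) u = 0"
  using assms funpow_v_eq_0[of p "part_a lam p"] vec.linear_0[OF vec.linear_funpow[OF linear_X]]
  by auto

lemma funpow_v_in_span_shifted: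
  assumes u: "u = (if p \<le> length lam then v p else 0)"
    and i: "i \<in> insert p {1..Suc k}" and s: "s < part_a lam i"
  shows "(X ^^ s) (v i)
    \<in> vec.span (kX_span X (insert (u + X (v (Suc k))) (v ` {1..k})) \<union> kX X u \<union> {v (Suc k)})"
proof -
  define M where "M = kX_span X (insert (u + X (v (Suc k))) (v ` {1..k}))"
  have in_S: "x \<in> vec.span (M \<union> kX X u \<union> {v (Suc k)})"
    if "x \<in> M \<or> x \<in> kX X u \<or> x = v (Suc k)" for x
    using that vec.span_base[of x "M \<union> kX X u \<union> {v (Suc k)}"] by blast
  consider "i = p" | "i \<in> {1..k}" | "i = Suc k" using i by fastforce
  then have "(X ^^ s) (v i) \<in> vec.span (M \<union> kX X u \<union> {v (Suc k)})"
  proof cases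
    case 1
    then have "(X ^^ s) (v i) \<in> kX X u"
      using funpow_u_eq[OF u] s funpow_in_kX[of s X u] by simp
    then show ?thesis by (intro in_S) blast
  next
    case 2
    then have "kX X (v i) \<subseteq> M"
      unfolding M_def by (intro kX_subset_kX_span) simp
    then have "(X ^^ s) (v i) \<in> M"
      by (rule subsetD[OF _ funpow_in_kX])
    then show ?thesis by (intro in_S) blast
  next
    case 3
    show ?thesis
    proof (cases s)
      case 0
      then show ?thesis using 3 by (intro in_S) simp
    next
      case (Suc r)
      have "(X ^^ r) (u + X (v (Suc k))) \<in> M"
        unfolding M_def by (rule funpow_in_kX_span[OF linear_X in_kX_span]) simp
      then have shifted: "(X ^^ r) (u + X (v (Suc k))) \<in> vec.span (M \<union> kX X u \<union> {v (Suc k)})"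
        by (intro in_S) blast
      have "(X ^^ r) u \<in> vec.span (M \<union> kX X u \<union> {v (Suc k)})"
        using funpow_in_kX by (intro in_S) blast
      moreover have "(X ^^ s) (v i) = (X ^^ r) (u + X (v (Suc k))) - (X ^^ r) u"
        unfolding Suc 3 vec.linear_add[OF vec.linear_funpow[OF linear_X]]
        by (simp add: funpow_swap1)
      ultimately show ?thesis
        using vec.span_diff[OF shifted] by simp
    qed
  qed
  then show ?thesis unfolding M_def .
qed

lemma enh_number_le_dim_kX_span_shifted:
  assumes p: "q < p" "q = parts_gt lam (part_a lam p)"
    and u: "u = (if p \<le> length lam then v p else 0)" and "k < q"
  shows "enh_number lam q k \<le> vec.dim (kX_span X (insert (u + X (v (Suc k))) (v ` {1..k})))"
proof -
  define M where "M = kX_span X (insert (u + X (v (Suc k))) (v ` {1..k}))"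
  have "part_a lam p < part_a lam (Suc k)"
    using le_parts_gt_iff[of "Suc k" "part_a lam p"] \<open>k < q\<close> p by simp
  have "p \<notin> {1..Suc k}" using p \<open>k < q\<close> by simp
  \<comment> \<open>Adjoining the cyclic space of u (of dimension at most a_p) and the single vector v_(k+1)
    yields the Jordan blocks 1, ..., k + 1 and p.\<close>
  then have "(\<Sum>i=1..Suc k. part_a lam i) + part_a lam p \<le> vec.dim (M \<union> kX X u \<union> {v (Suc k)})"
    using sum_part_a_le_dim[of "insert p {1..Suc k}", OF _ _ funpow_v_in_span_shifted[OF u, where k = k]] p
    unfolding M_def by simp
  also have "\<dots> \<le> vec.dim M + vec.dim (kX X u) + 1"
    using vec.dim_Un_le[of M "kX X u"] vec.dim_insert[of "v (Suc k)"] by simp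
  also have "vec.dim (kX X u) \<le> part_a lam p"
    using dim_kX_le[OF linear_X funpow_part_a_eq_0[OF _ u]] p(1) by simp
  finally show ?thesis
    using \<open>part_a lam p < part_a lam (Suc k)\<close> \<open>k < q\<close> unfolding enh_number_def M_def by simp
qed

lemma enh_number_le_dim_kX_span_unshifted:
  assumes p: "q < p" "q = parts_gt lam (part_a lam p)"
    and u: "u = (if p \<le> length lam then v p else 0)" and "q \<le> k"
  shows "enh_number lam q k
    \<le> vec.dim (kX_span X (insert u ((\<lambda>i. v (if i < p then i else Suc i)) ` {1..k})))"
proof -
  define \<nu> where "\<nu> i = v (if i < p then i else Suc i)" for i
  define M where "M = kX_span X (insert u (\<nu> ` {1..k}))"
  define I where "I = (if p \<le> Suc k then {1..Suc k} else insert p {1..k})"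
  have "(X ^^ s) (v i) \<in> M" if i: "i \<in> I" and s: "s < part_a lam i" for i s
  proof (cases "i = p")
    case True
    then have "(X ^^ s) (v i) = (X ^^ s) u"
      using funpow_u_eq[OF u] s by simp
    moreover have "kX X u \<subseteq> M"
      unfolding M_def by (intro kX_subset_kX_span) simp
    ultimately show ?thesis
      using funpow_in_kX[of s X u] by auto
  next
    case False
    then obtain l where "l \<in> {1..k}" "(if l < p then l else Suc l) = i"
      using skip_index_surj[of i p k] i p(1) unfolding I_def by auto
    then have "v i \<in> insert u (\<nu> ` {1..k})"
      unfolding \<nu>_def by (auto intro!: image_eqI[where x = l])
    then have "kX X (v i) \<subseteq> M"
      unfolding M_def by (rule kX_subset_kX_span)
    then show ?thesis by (rule subsetD[OF _ funpow_in_kX])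
  qed
  then have "(\<Sum>i\<in>I. part_a lam i) \<le> vec.dim M"
    using p(1) by (intro sum_part_a_le_dim) (auto simp: I_def M_def)
  also have "(\<Sum>i\<in>I. part_a lam i) = (\<Sum>i=1..Suc k. part_a lam i)"
  proof (cases "p \<le> Suc k")
    case False
    have "part_a lam (Suc k) \<le> part_a lam p"
      using le_parts_gt_iff[of "Suc k" "part_a lam p"] p(2) \<open>q \<le> k\<close> by simp
    then have "part_a lam p = part_a lam (Suc k)"
      using part_a_antimono[of "Suc k" p] False by simp
    then show ?thesis
      using False unfolding I_def by simp
  qed (simp add: I_def)
  finally show ?thesis
    using \<open>q \<le> k\<close> unfolding enh_number_def M_def \<nu>_def by simp
qed

lemma Max_dim_kX_span_eq_enh_number:
  assumes p: "q < p" "q = parts_gt lam (part_a lam p)"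
    and u: "u = (if p \<le> length lam then v p else 0)"
  shows "Max {vec.dim (kX_span X (insert w' (\<nu> ` {1..k}))) | w' \<nu>. w' \<in> (\<lambda>z. u + z) ` range X}
    = enh_number lam q k" (is "Max ?A = _")
proof (rule Max_eqI)
  have bound: "d \<le> enh_number lam q k" if "d \<in> ?A" for d
    using that dim_kX_span_le_enh_number[OF p(2) funpow_part_a_eq_0[OF _ u]] p(1) by auto
  then show "finite ?A"
    using finite_subset[of ?A "{..enh_number lam q k}"] by auto
  show "d \<le> enh_number lam q k" if "d \<in> ?A" for d
    using bound[OF that] .
  show "enh_number lam q k \<in> ?A"
  proof (cases "k < q")
    case True
    let ?d = "vec.dim (kX_span X (insert (u + X (v (Suc k))) (v ` {1..k})))"
    have mem: "?d \<in> ?A" by blast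
    have "enh_number lam q k \<le> ?d"
      by (rule enh_number_le_dim_kX_span_shifted[OF p u True])
    then have "?d = enh_number lam q k"
      using bound[OF mem] by simp
    then show ?thesis using mem by simp
  next
    case False
    let ?\<nu> = "\<lambda>i. v (if i < p then i else Suc i)"
    let ?d = "vec.dim (kX_span X (insert u (?\<nu> ` {1..k})))"
    have "u + X 0 \<in> (\<lambda>z. u + z) ` range X" by blast
    then have "u \<in> (\<lambda>z. u + z) ` range X"
      using vec.linear_0[OF linear_X] by simp
    then have mem: "?d \<in> ?A" by blast
    have "enh_number lam q k \<le> ?d"
      using False by (intro enh_number_le_dim_kX_span_unshifted[OF p u]) simp
    then have "?d = enh_number lam q k"
      using bound[OF mem] by simp
    then show ?thesis using mem by simp
  qed
qed

end

section \<open>The enhanced orbit\<close>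

lemma Ad_action_eq:
  assumes "is_GL g" "(X, w) = Ad_action g y X0 u" "Vector_Spaces.linear (*s) (*s) X0"
  shows "X = g \<circ> X0 \<circ> inv g" and "(\<lambda>z. w + z) ` range X = g ` (\<lambda>z. u + z) ` range X0"
proof -
  have g: "Vector_Spaces.linear (*s) (*s) g" "bij g"
    using assms(1) unfolding is_GL_def by auto
  have g_inv: "Vector_Spaces.linear (*s) (*s) (inv g)"
    by (rule vec.inj_linear_imp_inv_linear[OF g(1) bij_is_inj[OF g(2)]])
  show X: "X = g \<circ> X0 \<circ> inv g"
    using assms(2) unfolding Ad_action_def by simp
  have w: "w = g u - X y"
    using assms(2) unfolding Ad_action_def by simp
  have shift: "w + X z = g (u + X0 (inv g z - inv g y))" for z
    unfolding w X using g(1) assms(3) by (simp add: vec.linear_add vec.linear_diff algebra_simps)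
  show "(\<lambda>z. w + z) ` range X = g ` (\<lambda>z. u + z) ` range X0"
  proof (intro subset_antisym subsetI)
    fix x assume "x \<in> (\<lambda>z. w + z) ` range X"
    then show "x \<in> g ` (\<lambda>z. u + z) ` range X0"
      using shift by auto
  next
    fix x assume "x \<in> g ` (\<lambda>z. u + z) ` range X0"
    then obtain z where "x = g (u + X0 z)" by auto
    moreover have "inv g (y + g z) - inv g y = z"
      using vec.linear_add[OF g_inv] bij_is_inj[OF g(2)] by simp
    ultimately have "x = w + X (y + g z)"
      using shift[of "y + g z"] by simp
    then show "x \<in> (\<lambda>z. w + z) ` range X" by blast
  qed
qed

theorem lemma3p9:
  fixes X :: "'k::alg_closed_field ^ 'n \<Rightarrow> 'k ^ 'n" and w :: "'k ^ 'n"
    and lam :: "nat list" and q k :: nat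
  assumes "is_partition_of lam CARD('n)"
    and "(X, w) \<in> enh_orbit lam q"
    and "k \<le> length lam"
  shows "enh_number lam q k =
    Max {vec.dim (vec.span (kX X w' \<union> (\<Union>i\<in>{1..k}. kX X (\<nu> i)))) | w' \<nu>.
           w' \<in> (\<lambda>z. w + z) ` range X}"
proof -
  obtain g y X0 v j where GL: "is_GL g" and XW: "(X, w) = Ad_action g y X0 (u_vec lam v j)"
    and X0: "Vector_Spaces.linear (*s) (*s) X0" "jordan_basis X0 lam v"
    and j: "enh_index lam q j"
    using assms(2) unfolding enh_orbit_def by blast
  interpret jordan_nilpotent lam X0 v
    using assms(1) X0
    unfolding jordan_nilpotent_def jordan_nilpotent_axioms_def nat_partition_def by blast
  obtain p where p: "q < p" "q = parts_gt lam (part_a lam p)"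
    and u: "u_vec lam v j = (if p \<le> length lam then v p else 0)"
    by (rule enh_index_witness[OF j])
  have g: "Vector_Spaces.linear (*s) (*s) g" "bij g"
    using GL unfolding is_GL_def by auto
  show ?thesis
    unfolding kX_span_insert_image[symmetric] Ad_action_eq(2)[OF GL XW X0(1)]
    unfolding Ad_action_eq(1)[OF GL XW X0(1)] dims_kX_span_conj[OF g]
    by (rule Max_dim_kX_span_eq_enh_number[OF p u, symmetric])
qed

end
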